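(* Let $t=1/L$ and suppose the sharpness condition holds: there is $\lambda_s>0$ with $F(x)-F(x_\star)\ge\lambda_s\Delta(x)$ for all $x\in\mathbb{R}^n$. Let $\{x^k\}_{k=0}^\infty\subset\mathbb{R}^n$. (a) (Low accuracy) Let $\rho_l>0$. If $F(x^0)-F(x_\star)\le\lambda_s^2/(2L)$ and, for every $k\in\mathbb{N}$, $$F_t(x^{k+1};x^k)-\min_{x\in\mathbb{R}^n}F_t(x;x^k)\le\rho_l\left(F_t(x^k;x^k)-F_t(x^{k+1};x^k)\right),$$ then $$\Delta(x^k)\le\frac{F(x^0)-F(x_\star)}{\lambda_s}\left(\frac{1+4\rho_l}{2+4\rho_l}\right)^k,\qquad\forall k\in\mathbb{N}.$$ (b) (High accuracy) Let $0<\rho_h<1/4$. If $\Delta(x^0)\le\frac{\lambda_s(1-4\rho_h)}{2(1-3\rho_h)L}$ and, for every $k\in\mathbb{N}$, $$F_t(x^{k+1};x^k)-\min_{x\in\mathbb{R}^n}F_t(x;x^k)\le\frac{\rho_h}{2t}\|x^{k+1}-x^k\|_2^2,$$ then $$\Delta(x^k)\le\frac{\lambda_s(1-4\rho_h)}{L(1-3\rho_h)}\,\zeta^{2^k},\qquad\forall k\in\mathbb{N},\qquad\text{where }\zeta=\frac{L\Delta(x^0)(1-3\rho_h)}{\lambda_s(1-4\rho_h)}.$$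
   Context: Let $m,n\ge1$, $a_1,\dots,a_m\in\mathbb{R}^n$, let $A\in\mathbb{R}^{m\times n}$ be the matrix with rows $a_i^\top$, let $x_\star\in\mathbb{R}^n$ be the true signal, and let $b\in\mathbb{R}^m$ with $b_i=(a_i^\top x_\star)^2$ for $i\in\mathbb{I}_1$ and $b_i=\xi_i$ (arbitrary noise) for $i\in\mathbb{I}_2$, where $\mathbb{I}_1,\mathbb{I}_2$ are disjoint with union $\{1,\dots,m\}$. Put $c(x)=|Ax|^2-b$ (entrywise square), $h(z)=\frac1m\|z\|_1$, and $F(x)=h(c(x))=\frac1m\sum_{i=1}^m|(a_i^\top x)^2-b_i|$. $\nabla c(y)=2\,\mathrm{diag}(Ay)A$ is the Jacobian of $c$, and $L=\frac2m\|A\|_2^2$ with $\|A\|_2$ the spectral norm. For $t>0$ define $F(z;y)=h(c(y)+\nabla c(y)(z-y))$ and $F_t(z;y)=F(z;y)+\frac1{2t}\|z-y\|_2^2$. Finally $\Delta(x)=\min\{\|x-x_\star\|_2,\|x+x_\star\|_2\}$. $\mathbb{N}$ includes $0$. *)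

theory Defs
  imports "HOL-Analysis.Analysis"
begin

definition diag_mat :: "real^'m \<Rightarrow> real^'m^'m" where
  "diag_mat v = (\<chi> i j. if i = j then v $ i else 0)"

definition spectral_norm :: "real^'n^'m \<Rightarrow> real" where
  "spectral_norm A = onorm ((*v) A)"

definition residual :: "real^'n^'m \<Rightarrow> real^'m \<Rightarrow> real^'n \<Rightarrow> real^'m" where
  "residual A b x = (\<chi> i. ((A *v x) $ i)\<^sup>2 - b $ i)"

definition residual_jac :: "real^'n^'m \<Rightarrow> real^'n \<Rightarrow> real^'n^'m" where
  "residual_jac A y = 2 *\<^sub>R (diag_mat (A *v y) ** A)"

definition mean_l1 :: "real^'m \<Rightarrow> real" where
  "mean_l1 z = (1 / real CARD('m)) * (\<Sum>i\<in>UNIV. \<bar>z $ i\<bar>)"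

definition objective :: "real^'n^'m \<Rightarrow> real^'m \<Rightarrow> real^'n \<Rightarrow> real" where
  "objective A b x = mean_l1 (residual A b x)"

definition lin_model :: "real^'n^'m \<Rightarrow> real^'m \<Rightarrow> real^'n \<Rightarrow> real^'n \<Rightarrow> real" where
  "lin_model A b z y = mean_l1 (residual A b y + residual_jac A y *v (z - y))"

definition prox_model :: "real \<Rightarrow> real^'n^'m \<Rightarrow> real^'m \<Rightarrow> real^'n \<Rightarrow> real^'n \<Rightarrow> real" where
  "prox_model t A b z y = lin_model A b z y + (1 / (2 * t)) * (norm (z - y))\<^sup>2"

text \<open>The infimum is a minimum whenever \<open>t > 0\<close>, see \<open>prox_model_min_attained\<close> below.\<close>

definition prox_model_min :: "real \<Rightarrow> real^'n^'m \<Rightarrow> real^'m \<Rightarrow> real^'n \<Rightarrow> real" where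
  "prox_model_min t A b y = (INF x. prox_model t A b x y)"

definition smoothness_const :: "real^'n^'m \<Rightarrow> real" where
  "smoothness_const A = (2 / real CARD('m)) * (spectral_norm A)\<^sup>2"

text \<open>Quadratic measurements determine the signal only up to its sign.\<close>

definition sign_dist :: "real^'n \<Rightarrow> real^'n \<Rightarrow> real" where
  "sign_dist xs x = min (norm (x - xs)) (norm (x + xs))"

lemma objective_rows:
  fixes a :: "'m::finite \<Rightarrow> real^'n"
  shows "objective (\<chi> i. a i) b x = (1 / real CARD('m)) * (\<Sum>i\<in>UNIV. \<bar>(a i \<bullet> x)\<^sup>2 - b $ i\<bar>)"
  by (simp add: objective_def mean_l1_def residual_def matrix_vector_mul_component)

lemma residual_jac_component:
  "(residual_jac A y *v v) $ i = 2 * (A *v y) $ i * (A *v v) $ i"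
proof -
  have "(diag_mat (A *v y) *v w) $ i = (A *v y) $ i * w $ i" for w
    by (simp add: diag_mat_def matrix_vector_mult_def if_distrib[of "\<lambda>u. u * _"] cong: if_cong)
  then show ?thesis
    by (simp add: residual_jac_def scaleR_matrix_vector_assoc[symmetric] matrix_vector_mul_assoc[symmetric])
qed

lemma residual_has_derivative:
  "(residual A b has_derivative (*v) (residual_jac A y)) (at y)"
proof -
  have "((\<lambda>x. ((A *v x) $ i)\<^sup>2 - b $ i) has_derivative
         (\<lambda>v. (residual_jac A y *v v) $ i)) (at y)" for i
  proof -
    have "((\<lambda>x. (A *v x) $ i) has_derivative (\<lambda>v. (A *v v) $ i)) (at y)"
      by (intro bounded_linear_imp_has_derivative bounded_linear_compose[OF bounded_linear_vec_nth]
            matrix_vector_mul_bounded_linear)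
    then show ?thesis
      by (auto intro!: derivative_eq_intros simp: residual_jac_component)
  qed
  then show ?thesis
    by (subst has_derivative_componentwise_within)
      (auto simp: residual_def Basis_vec_def inner_axis)
qed

lemma prox_model_min_attained:
  assumes "t > 0"
  shows "\<exists>z. prox_model t A b z y = prox_model_min t A b y \<and>
             (\<forall>x. prox_model_min t A b y \<le> prox_model t A b x y)"
proof -
  let ?f = "\<lambda>x. prox_model t A b x y"
  define r where "r = 1 + 2 * t * ?f y"
  have f_ge: "?f x \<ge> (1 / (2 * t)) * (norm (x - y))\<^sup>2" for x
    by (simp add: prox_model_def lin_model_def mean_l1_def sum_nonneg)
  have "?f y \<ge> 0"
    using f_ge[of y] by simp
  then have r: "r \<ge> 1"
    using assms by (simp add: r_def)
  have "continuous_on (cball y r) ?f"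
    unfolding prox_model_def lin_model_def mean_l1_def
    by (intro continuous_intros
          bounded_linear.continuous_on[OF matrix_vector_mul_bounded_linear])
  then obtain z where z: "z \<in> cball y r" "\<And>x. x \<in> cball y r \<Longrightarrow> ?f z \<le> ?f x"
    using continuous_attains_inf[of "cball y r" ?f] r by auto
  have min: "?f z \<le> ?f x" for x
  proof (cases "x \<in> cball y r")
    case False
    then have d: "r < norm (x - y)"
      by (simp add: dist_norm norm_minus_commute)
    have "2 * t * ?f y \<le> r * 1"
      by (simp add: r_def)
    also have "\<dots> \<le> r\<^sup>2"
      using r unfolding power2_eq_square by (intro mult_left_mono) auto
    also have "\<dots> \<le> (norm (x - y))\<^sup>2"
      using d r by (intro power_mono) auto
    finally have "?f y \<le> (1 / (2 * t)) * (norm (x - y))\<^sup>2"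
      using assms by (simp add: field_simps)
    then show ?thesis
      using f_ge[of x] z(2)[of y] r by simp
  qed (use z in blast)
  have "prox_model_min t A b y = ?f z"
    unfolding prox_model_min_def
  proof (rule cInf_eq_minimum)
    show "?f z \<in> range ?f"
      by (rule rangeI)
    show "?f z \<le> v" if "v \<in> range ?f" for v
      using that min by (elim imageE) simp
  qed
  then show ?thesis
    using min by (intro exI[of _ z]) simp
qed

end

theory Submission
  imports Defs
begin

text \<open>
  The model is two-sidedly accurate, \<open>\<bar>F(z) - F(z;y)\<bar> \<le> L/2 * |z - y|\<^sup>2\<close>, so with \<open>t = 1/L\<close> the proximal
  model majorizes \<open>F\<close>, and evaluating it at the point of \<open>{x_star, -x_star}\<close> nearest to the current
  iterate \<open>x\<close> gives \<open>min F_t(.;x) - F(x_star) \<le> L * \<Delta>(x)\<^sup>2\<close>. In the low accuracy regime sharpness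
  turns this into at most half the current gap, hence a linear decrease of the gap. In the high
  accuracy regime, strong convexity of the proximal model bounds the step length by \<open>\<Delta>(x)\<close> and
  distances to the exact minimizer, the latter being absorbed by the strong convexity gain at
  the nearest signal, which yields \<open>\<lambda> * \<Delta>(x_next) \<le> L * (1 - 3\<rho>)/(1 - 4\<rho>) * \<Delta>(x)\<^sup>2\<close>.
\<close>

section \<open>Accuracy of the linearized model\<close>

lemma mean_l1_triangle: "mean_l1 (u + v) \<le> mean_l1 u + mean_l1 v"
proof -
  have "(\<Sum>i\<in>UNIV. \<bar>(u + v) $ i\<bar>) \<le> (\<Sum>i\<in>UNIV. \<bar>u $ i\<bar> + \<bar>v $ i\<bar>)"
    by (intro sum_mono) (simp add: abs_triangle_ineq)
  then show ?thesis
    by (simp add: mean_l1_def sum.distrib add_divide_distrib[symmetric] divide_right_mono)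
qed

lemma mean_l1_scaleR: "mean_l1 (s *\<^sub>R u) = \<bar>s\<bar> * mean_l1 u"
  by (simp add: mean_l1_def abs_mult sum_distrib_left[symmetric])

lemma mean_l1_minus: "mean_l1 (- u) = mean_l1 u"
  by (simp add: mean_l1_def)

lemma abs_mean_l1_diff_le: "\<bar>mean_l1 u - mean_l1 v\<bar> \<le> mean_l1 (u - v)"
  using mean_l1_triangle[of "u - v" v] mean_l1_triangle[of "v - u" u] mean_l1_minus[of "u - v"]
  by simp

lemma convex_on_mean_l1: "convex_on UNIV mean_l1"
proof (intro convex_onI)
  show "mean_l1 ((1 - s) *\<^sub>R u + s *\<^sub>R v) \<le> (1 - s) * mean_l1 u + s * mean_l1 v"
    if "0 < s" "s < 1" for s and u v :: "real^'m"
    using mean_l1_triangle[of "(1 - s) *\<^sub>R u" "s *\<^sub>R v"] that by (simp add: mean_l1_scaleR)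
qed simp

text \<open>Each component of \<open>residual\<close> is quadratic, so its Taylor expansion at
  \<open>y\<close> ends at second order and leaves a pure square.\<close>

lemma residual_linearization_error:
  "(residual A b z - (residual A b y + residual_jac A y *v (z - y))) $ i = ((A *v (z - y)) $ i)\<^sup>2"
  by (simp add: residual_jac_component)
    (simp add: residual_def matrix_vector_mult_diff_distrib power2_eq_square algebra_simps)

text \<open>Half of \<open>smoothness_const A\<close> is the squared spectral norm over the number
  of rows, which is what the operator norm bound gives after averaging.\<close>

lemma mean_squares_le_smoothness:
  fixes A :: "real^'n^'m"
  shows "(1 / real CARD('m)) * (\<Sum>i\<in>UNIV. ((A *v v) $ i)\<^sup>2) \<le> smoothness_const A / 2 * (norm v)\<^sup>2"
proof -
  have "(\<Sum>i\<in>UNIV. ((A *v v) $ i)\<^sup>2) = (norm (A *v v))\<^sup>2"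
    by (simp add: norm_vec_def L2_set_def sum_nonneg)
  also have "\<dots> \<le> (spectral_norm A * norm v)\<^sup>2"
    unfolding spectral_norm_def
    by (intro power_mono onorm matrix_vector_mul_bounded_linear) auto
  finally show ?thesis
    by (simp add: smoothness_const_def power_mult_distrib divide_right_mono)
qed

lemma lin_model_error:
  fixes A :: "real^'n^'m"
  shows "\<bar>objective A b z - lin_model A b z y\<bar> \<le> smoothness_const A / 2 * (norm (z - y))\<^sup>2"
proof -
  have "\<bar>objective A b z - lin_model A b z y\<bar>
      \<le> mean_l1 (residual A b z - (residual A b y + residual_jac A y *v (z - y)))"
    unfolding objective_def lin_model_def by (rule abs_mean_l1_diff_le)
  also have "\<dots> = (1 / real CARD('m)) * (\<Sum>i\<in>UNIV. ((A *v (z - y)) $ i)\<^sup>2)"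
    unfolding mean_l1_def residual_linearization_error by simp
  finally show ?thesis
    using mean_squares_le_smoothness[of A "z - y"] by linarith
qed

lemma prox_model_at_center: "prox_model t A b y y = objective A b y"
  by (simp add: prox_model_def lin_model_def objective_def)

section \<open>Convexity and quadratic growth of the proximal model\<close>

lemma convex_on_lin_model:
  fixes A :: "real^'n^'m"
  shows "convex_on UNIV (\<lambda>z. lin_model A b z y)"
proof (intro convex_onI)
  fix s :: real and u v :: "real^'n"
  assume s: "0 < s" "s < 1"
  \<comment> \<open>The argument of \<open>mean_l1\<close> is affine in the first variable: the
    weights sum to one, so its constant part splits as well.\<close>
  have combination: "residual A b y + residual_jac A y *v ((1 - s) *\<^sub>R u + s *\<^sub>R v - y)
      = (1 - s) *\<^sub>R (residual A b y + residual_jac A y *v (u - y))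
        + s *\<^sub>R (residual A b y + residual_jac A y *v (v - y))"
    by (simp add: vec_eq_iff residual_jac_component matrix_vector_mult_diff_distrib
        matrix_vector_right_distrib matrix_vector_mult_scaleR algebra_simps)
  show "lin_model A b ((1 - s) *\<^sub>R u + s *\<^sub>R v) y
      \<le> (1 - s) * lin_model A b u y + s * lin_model A b v y"
    unfolding lin_model_def combination
    using s by (intro convex_onD[OF convex_on_mean_l1]) auto
qed simp

text \<open>Minimality of \<open>z\<close> is tested on the segment from \<open>z\<close> to
  \<open>x\<close>. There the squared distance to \<open>y\<close> falls short of linear
  interpolation by \<open>s * (1 - s)\<close> times the squared length of the segment, and this
  deficit is the source of the growth term.\<close>

lemma convex_plus_square_growth:
  fixes f :: "'a::real_inner \<Rightarrow> real"
  assumes f: "convex_on UNIV f"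
    and min: "\<And>x. f z + c * (norm (z - y))\<^sup>2 \<le> f x + c * (norm (x - y))\<^sup>2"
  shows "f z + c * (norm (z - y))\<^sup>2 + c * (norm (x - z))\<^sup>2 \<le> f x + c * (norm (x - y))\<^sup>2"
proof -
  define g where "g u = f u + c * (norm (u - y))\<^sup>2" for u
  define d where "d = c * (norm (x - z))\<^sup>2"
  have "(1 - s) * d \<le> g x - g z" if s: "0 < s" "s < 1" for s
  proof -
    let ?w = "(1 - s) *\<^sub>R z + s *\<^sub>R x"
    have norm_w: "(norm (?w - y))\<^sup>2
        = (1 - s) * (norm (z - y))\<^sup>2 + s * (norm (x - y))\<^sup>2 - s * (1 - s) * (norm (x - z))\<^sup>2"
      unfolding power2_norm_eq_inner
      by (simp add: inner_simps inner_commute algebra_simps)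
    have "c * (norm (?w - y))\<^sup>2
        = (1 - s) * (c * (norm (z - y))\<^sup>2) + s * (c * (norm (x - y))\<^sup>2) - s * (1 - s) * d"
      unfolding norm_w d_def by (simp add: algebra_simps)
    moreover have "f ?w \<le> (1 - s) * f z + s * f x"
      using convex_onD[OF f, of s z x] s by simp
    moreover have "g z \<le> g ?w"
      unfolding g_def by (rule min)
    ultimately have "g z \<le> (1 - s) * g z + s * g x - s * (1 - s) * d"
      unfolding g_def by (simp add: distrib_left)
    then have "s * ((1 - s) * d) \<le> s * (g x - g z)"
      by (simp add: algebra_simps)
    then show ?thesis
      using s by simp
  qed
  \<comment> \<open>The comparison was divided by \<open>s\<close>, so the full constant
    \<open>d\<close> is reached only in the limit of \<open>s\<close> to 0 from the right.\<close>
  then have "\<forall>\<^sub>F s in at_right 0. (1 - s) * d \<le> g x - g z"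
    unfolding eventually_at_right_field by (intro exI[of _ 1]) auto
  moreover have "((\<lambda>s. (1 - s) * d) \<longlongrightarrow> (1 - 0) * d) (at_right 0)"
    by (intro tendsto_intros)
  ultimately have "d \<le> g x - g z"
    using tendsto_upperbound[of "\<lambda>s. (1 - s) * d" d "at_right 0" "g x - g z"] by simp
  then show ?thesis
    by (simp add: g_def d_def)
qed

lemma prox_model_growth:
  assumes "prox_model t A b z y = prox_model_min t A b y"
    and "\<And>x. prox_model_min t A b y \<le> prox_model t A b x y"
  shows "prox_model_min t A b y + 1 / (2 * t) * (norm (x - z))\<^sup>2 \<le> prox_model t A b x y"
  using convex_plus_square_growth[OF convex_on_lin_model[of A b y], where z = z and x = x
      and y = y and c = "1 / (2 * t)"] assms
  by (simp add: prox_model_def)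

section \<open>Sign ambiguity and sharpness\<close>

lemma objective_minus: "objective A b (- z) = objective A b z"
  using matrix_vector_mult_diff_distrib[of A 0 z]
  by (simp add: objective_def residual_def)

lemma sign_dist_nonneg: "0 \<le> sign_dist xs z"
  by (simp add: sign_dist_def)

text \<open>The objective is even, so both signs of the signal have the same value, and the nearer
  one serves as the comparison point in the model.\<close>

lemma sign_dist_attained:
  obtains p where "norm (z - p) = sign_dist xs z" "objective A b p = objective A b xs"
proof (cases "norm (z - xs) \<le> norm (z + xs)")
  case True
  then show ?thesis
    using that[of xs] by (simp add: sign_dist_def)
next
  case False
  then show ?thesis
    using that[of "- xs"] by (simp add: sign_dist_def objective_minus)
qed

text \<open>If the constant vanished, \<open>A\<close> would act as zero and the objective would be
  constant, against the growth forced by sharpness. Positivity makes \<open>1 / L\<close> a genuine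
  step size.\<close>

lemma smoothness_const_pos_if_sharp:
  fixes A :: "real^'n^'m"
  assumes sharp: "\<And>z. objective A b z - objective A b xs \<ge> lam * sign_dist xs z"
    and "lam > 0"
  shows "smoothness_const A > 0"
proof (rule ccontr)
  assume "\<not> smoothness_const A > 0"
  then have "spectral_norm A = 0"
    by (simp add: smoothness_const_def zero_less_divide_iff)
  then have "A *v z = 0" for z
    by (simp add: spectral_norm_def onorm_eq_0)
  then have F: "objective A b z = objective A b xs" for z
    by (simp add: objective_def residual_def)
  \<comment> \<open>A norm exceeding that of \<open>xs\<close> by 1 keeps \<open>z\<close> at
    distance at least 1 from both \<open>xs\<close> and \<open>- xs\<close>.\<close>
  obtain z :: "real^'n" where "norm z = norm xs + 1"
    using vector_choose_size[of "norm xs + 1"] by auto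
  then have "sign_dist xs z > 0"
    using norm_triangle_ineq2[of z xs] norm_triangle_ineq2[of z "- xs"]
    by (auto simp: sign_dist_def)
  then show False
    using sharp[of z] F[of z] \<open>lam > 0\<close> by (simp add: mult_le_0_iff)
qed

section \<open>Elementary inequalities for squares\<close>

lemma weighted_square_sum_le:
  fixes p q e g :: real
  assumes "e > 0" "g > 0" "e + g = 1"
  shows "(p + q)\<^sup>2 \<le> p\<^sup>2 / e + q\<^sup>2 / g"
proof -
  have "p\<^sup>2 / e + q\<^sup>2 / g - (p + q)\<^sup>2 = (g * p - e * q)\<^sup>2 / (e * g)"
    using assms by (simp add: divide_simps) algebra
  then show ?thesis
    using assms by (smt (verit) zero_le_divide_iff zero_le_power2 mult_pos_pos)
qed

text \<open>The weights are chosen so that \<open>d\<close> enters with coefficient exactly 1/2, which is the strong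
  convexity gain available in \<open>prox_step_high_accuracy\<close>.\<close>

lemma inexact_step_length_bound:
  fixes r w d D \<rho> :: real
  assumes \<rho>: "0 < \<rho>" "\<rho> < 1 / 4"
    and r: "0 \<le> r" "r \<le> D + d + w"
    and w: "w\<^sup>2 \<le> \<rho> * r\<^sup>2"
  shows "\<rho> / 2 * r\<^sup>2 \<le> \<rho> / (1 - 4 * \<rho>) * D\<^sup>2 + d\<^sup>2 / 2"
proof -
  have "r\<^sup>2 \<le> ((D + d) + w)\<^sup>2"
    using r by (intro power_mono)
  \<comment> \<open>Equal weights turn \<open>w\<close> into at most
    \<open>2 * \<rho> * r\<^sup>2\<close>, which moves to the left-hand side.\<close>
  also have "\<dots> \<le> (D + d)\<^sup>2 / (1 / 2) + w\<^sup>2 / (1 / 2)"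
    by (intro weighted_square_sum_le) auto
  finally have "(1 - 2 * \<rho>) * r\<^sup>2 \<le> 2 * (D + d)\<^sup>2"
    using w by (simp add: algebra_simps)
  \<comment> \<open>The two weights sum to one, and \<open>\<rho> < 1 / 4\<close> keeps the first
    one positive.\<close>
  also have "(D + d)\<^sup>2 \<le> D\<^sup>2 / ((1 - 4 * \<rho>) / (1 - 2 * \<rho>)) + d\<^sup>2 / (2 * \<rho> / (1 - 2 * \<rho>))"
    using \<rho> by (intro weighted_square_sum_le) (auto simp: add_divide_distrib[symmetric])
  also have "\<dots> = (1 - 2 * \<rho>) * (D\<^sup>2 / (1 - 4 * \<rho>) + d\<^sup>2 / (2 * \<rho>))"
    using \<rho> by (simp add: distrib_left mult.commute)
  finally have "(1 - 2 * \<rho>) * r\<^sup>2 \<le> (1 - 2 * \<rho>) * (2 * (D\<^sup>2 / (1 - 4 * \<rho>) + d\<^sup>2 / (2 * \<rho>)))"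
    by (simp only: mult.left_commute)
  then have "r\<^sup>2 \<le> 2 * (D\<^sup>2 / (1 - 4 * \<rho>) + d\<^sup>2 / (2 * \<rho>))"
    using \<rho> by simp
  then have "\<rho> / 2 * r\<^sup>2 \<le> \<rho> / 2 * (2 * (D\<^sup>2 / (1 - 4 * \<rho>) + d\<^sup>2 / (2 * \<rho>)))"
    using \<rho> by (intro mult_left_mono) auto
  also have "\<dots> = \<rho> / (1 - 4 * \<rho>) * D\<^sup>2 + d\<^sup>2 / 2"
    using \<rho> by (simp add: distrib_left)
  finally show ?thesis .
qed

section \<open>One inexact proximal step\<close>

lemma objective_le_prox_model:
  assumes "t = 1 / smoothness_const A"
  shows "objective A b z \<le> prox_model t A b z y"
  using lin_model_error[of A b z y] unfolding abs_le_iff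
  by (simp add: prox_model_def assms)

text \<open>For this \<open>t\<close> the proximal term carries the same constant as the model
  error: it absorbs that error in \<open>objective_le_prox_model\<close> and doubles it
  here.\<close>

lemma prox_model_le_objective:
  assumes "t = 1 / smoothness_const A"
  shows "prox_model t A b z y \<le> objective A b z + smoothness_const A * (norm (z - y))\<^sup>2"
  using lin_model_error[of A b z y] unfolding abs_le_iff
  by (simp add: prox_model_def assms)

lemma prox_model_min_le:
  assumes "t > 0"
  shows "prox_model_min t A b y \<le> prox_model t A b x y"
  using prox_model_min_attained[OF assms] by metis

lemma prox_step_low_accuracy:
  assumes sharp: "\<And>z. objective A b z - objective A b xs \<ge> lam * sign_dist xs z"
    and "lam > 0" "\<rho> > 0"
    and L: "L = smoothness_const A" and t: "t = 1 / L"
    and gap: "objective A b y - objective A b xs \<le> lam\<^sup>2 / (2 * L)"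
    and inexact: "prox_model t A b u y - prox_model_min t A b y
      \<le> \<rho> * (prox_model t A b y y - prox_model t A b u y)"
  shows "objective A b u - objective A b xs
    \<le> (1 + 4 * \<rho>) / (2 + 4 * \<rho>) * (objective A b y - objective A b xs)"
proof -
  define D where "D = sign_dist xs y"
  define g where "g = objective A b y - objective A b xs"
  define h where "h = objective A b u - objective A b xs"
  have L_pos: "L > 0"
    using smoothness_const_pos_if_sharp[OF sharp \<open>lam > 0\<close>] L by simp
  have D: "0 \<le> lam * D" "lam * D \<le> g"
    using sharp[of y] sign_dist_nonneg[of xs y] \<open>lam > 0\<close> by (auto simp: D_def g_def)
  obtain p where p: "norm (y - p) = D" "objective A b p = objective A b xs"
    unfolding D_def by (rule sign_dist_attained)
  have "prox_model_min t A b y \<le> prox_model t A b p y"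
    using L_pos t by (intro prox_model_min_le) simp
  also have "\<dots> \<le> objective A b xs + L * D\<^sup>2"
    using prox_model_le_objective[of t A b p y] L t p by (simp add: norm_minus_commute)
  finally have min: "prox_model_min t A b y - objective A b xs \<le> L * D\<^sup>2"
    by simp
  \<comment> \<open>One factor \<open>lam * D\<close> is bounded by \<open>g\<close>, the other by
    the threshold \<open>lam\<^sup>2 / (2 * L)\<close>; this makes the quadratic error at most half
    the gap.\<close>
  have "lam\<^sup>2 * (L * D\<^sup>2) = L * (lam * D)\<^sup>2"
    by (simp add: power_mult_distrib)
  also have "\<dots> \<le> L * (g * (lam\<^sup>2 / (2 * L)))"
    using D gap L_pos unfolding power2_eq_square[of "lam * D"] g_def[symmetric]
    by (intro mult_left_mono mult_mono) auto
  also have "\<dots> = lam\<^sup>2 * (g / 2)"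
    using L_pos by simp
  finally have "L * D\<^sup>2 \<le> g / 2"
    using \<open>lam > 0\<close> by simp
  with min inexact have "(1 + \<rho>) * (prox_model t A b u y - objective A b xs) \<le> (1 / 2 + \<rho>) * g"
    by (simp add: prox_model_at_center g_def algebra_simps)
  moreover have "(1 + \<rho>) * h \<le> (1 + \<rho>) * (prox_model t A b u y - objective A b xs)"
    using objective_le_prox_model[of t A b u y] L t \<open>\<rho> > 0\<close>
    by (intro mult_left_mono) (auto simp: h_def)
  ultimately have "(1 + \<rho>) * h \<le> (1 / 2 + \<rho>) * g"
    by linarith
  \<comment> \<open>The step yields the factor \<open>(1 + s) / (2 + s)\<close> at
    \<open>s = 2 * \<rho>\<close>; it increases with \<open>s\<close>, and the claimed rate is its
    value at \<open>s = 4 * \<rho>\<close>.\<close>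
  moreover have "(1 / 2 + \<rho>) / (1 + \<rho>) \<le> (1 + 4 * \<rho>) / (2 + 4 * \<rho>)"
    using \<open>\<rho> > 0\<close> by (simp add: field_simps)
  then have "(1 / 2 + \<rho>) / (1 + \<rho>) * g \<le> (1 + 4 * \<rho>) / (2 + 4 * \<rho>) * g"
    using D by (intro mult_right_mono) auto
  ultimately show ?thesis
    using \<open>\<rho> > 0\<close> unfolding g_def[symmetric] h_def[symmetric]
    by (smt (verit) mult.commute pos_le_divide_eq times_divide_eq_left)
qed

lemma prox_step_high_accuracy:
  assumes sharp: "\<And>z. objective A b z - objective A b xs \<ge> lam * sign_dist xs z"
    and "lam > 0" and \<rho>: "0 < \<rho>" "\<rho> < 1 / 4"
    and L: "L = smoothness_const A" and t: "t = 1 / L"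
    and inexact: "prox_model t A b u y - prox_model_min t A b y
      \<le> \<rho> / (2 * t) * (norm (u - y))\<^sup>2"
  shows "lam * sign_dist xs u \<le> L * ((1 - 3 * \<rho>) / (1 - 4 * \<rho>)) * (sign_dist xs y)\<^sup>2"
proof -
  define D where "D = sign_dist xs y"
  have L_pos: "L > 0"
    using smoothness_const_pos_if_sharp[OF sharp \<open>lam > 0\<close>] L by simp
  obtain p where p: "norm (y - p) = D" "objective A b p = objective A b xs"
    unfolding D_def by (rule sign_dist_attained)
  obtain z where z: "prox_model t A b z y = prox_model_min t A b y"
      "\<And>x. prox_model_min t A b y \<le> prox_model t A b x y"
    using prox_model_min_attained[of t A b y] L_pos t by auto
  define r d w where "r = norm (u - y)" and "d = norm (p - z)" and "w = norm (u - z)"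
  \<comment> \<open>As \<open>1 / (2 * t)\<close> is \<open>L / 2\<close>, growth at
    \<open>u\<close> turns the allowed model error into a bound on the distance to the exact
    minimizer.\<close>
  have "L / 2 * w\<^sup>2 \<le> L / 2 * (\<rho> * r\<^sup>2)"
    using prox_model_growth[OF z, of u] inexact t by (simp add: r_def w_def algebra_simps)
  then have w: "w\<^sup>2 \<le> \<rho> * r\<^sup>2"
    using L_pos by simp
  \<comment> \<open>The path from \<open>y\<close> to \<open>u\<close> runs through the nearest
    signal \<open>p\<close> and the exact minimizer \<open>z\<close>.\<close>
  have "u - y = (p - y) + (z - p) + (u - z)"
    by simp
  then have "r \<le> D + d + w"
    unfolding r_def d_def w_def p(1)[symmetric]
    by (metis norm_minus_commute norm_triangle_ineq norm_triangle_mono order_refl)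
  then have step: "\<rho> / 2 * r\<^sup>2 \<le> \<rho> / (1 - 4 * \<rho>) * D\<^sup>2 + d\<^sup>2 / 2"
    using w \<rho> by (intro inexact_step_length_bound[where w = w]) (auto simp: r_def)
  \<comment> \<open>The growth term at \<open>p\<close> is kept, because it later cancels the
    \<open>d\<close> term of \<open>step\<close>.\<close>
  have "prox_model_min t A b y + L / 2 * d\<^sup>2 \<le> objective A b xs + L * D\<^sup>2"
    using prox_model_growth[OF z, of p] prox_model_le_objective[of t A b p y] L t p
    by (simp add: d_def norm_minus_commute)
  \<comment> \<open>Sharpness at \<open>u\<close>, majorization by the model and the inexactness
    bound are chained.\<close>
  then have "lam * sign_dist xs u \<le> L * D\<^sup>2 - L / 2 * d\<^sup>2 + L * (\<rho> / 2 * r\<^sup>2)"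
    using sharp[of u] objective_le_prox_model[of t A b u y] inexact L t
    by (simp add: r_def algebra_simps)
  also have "L * (\<rho> / 2 * r\<^sup>2) \<le> L * (\<rho> / (1 - 4 * \<rho>) * D\<^sup>2 + d\<^sup>2 / 2)"
    using step L_pos by (intro mult_left_mono) auto
  also have "L * D\<^sup>2 - L / 2 * d\<^sup>2 + L * (\<rho> / (1 - 4 * \<rho>) * D\<^sup>2 + d\<^sup>2 / 2)
      = L * (1 + \<rho> / (1 - 4 * \<rho>)) * D\<^sup>2"
    by (simp add: algebra_simps)
  also have "1 + \<rho> / (1 - 4 * \<rho>) = (1 - 3 * \<rho>) / (1 - 4 * \<rho>)"
    using \<rho> by (simp add: field_simps)
  finally show ?thesis
    by (simp add: D_def)
qed

section \<open>From one step to all iterates\<close>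

lemma quadratic_recursion_bound:
  fixes e :: "nat \<Rightarrow> real"
  assumes "\<And>k. 0 \<le> e k" "\<And>k. e (Suc k) \<le> (e k)\<^sup>2"
  shows "e k \<le> e 0 ^ (2 ^ k)"
proof (induction k)
  case (Suc k)
  have "e (Suc k) \<le> (e k)\<^sup>2"
    by (rule assms)
  also have "\<dots> \<le> (e 0 ^ (2 ^ k))\<^sup>2"
    using Suc assms by (intro power_mono)
  finally show ?case
    by (simp add: power_mult[symmetric] mult.commute)
qed simp

theorem theorem2:
  fixes a :: "'m::finite \<Rightarrow> real^'n"
    and A :: "real^'n^'m"
    and b :: "real^'m"
    and \<xi> :: "'m \<Rightarrow> real"
    and I1 I2 :: "'m set"
    and x_star :: "real^'n"
    and x :: "nat \<Rightarrow> real^'n"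
    and L t lam_s :: real
  assumes A: "A = (\<chi> i. a i)"
    and disj: "I1 \<inter> I2 = {}"
    and cover: "I1 \<union> I2 = UNIV"
    and b_clean: "\<And>i. i \<in> I1 \<Longrightarrow> b $ i = (a i \<bullet> x_star)\<^sup>2"
    and b_noise: "\<And>i. i \<in> I2 \<Longrightarrow> b $ i = \<xi> i"
    and L: "L = smoothness_const A"
    and t: "t = 1 / L"
    and lambda_pos: "lam_s > 0"
    and sharp: "\<And>z. objective A b z - objective A b x_star \<ge> lam_s * sign_dist x_star z"
  shows
    "(\<forall>\<rho>\<^sub>l>0.
        objective A b (x 0) - objective A b x_star \<le> lam_s\<^sup>2 / (2 * L) \<longrightarrow>
        (\<forall>k. prox_model t A b (x (Suc k)) (x k) - prox_model_min t A b (x k)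
               \<le> \<rho>\<^sub>l * (prox_model t A b (x k) (x k) - prox_model t A b (x (Suc k)) (x k))) \<longrightarrow>
        (\<forall>k. sign_dist x_star (x k)
               \<le> (objective A b (x 0) - objective A b x_star) / lam_s
                  * ((1 + 4 * \<rho>\<^sub>l) / (2 + 4 * \<rho>\<^sub>l)) ^ k))
     \<and>
     (\<forall>\<rho>\<^sub>h. 0 < \<rho>\<^sub>h \<longrightarrow> \<rho>\<^sub>h < 1 / 4 \<longrightarrow>
        sign_dist x_star (x 0) \<le> lam_s * (1 - 4 * \<rho>\<^sub>h) / (2 * (1 - 3 * \<rho>\<^sub>h) * L) \<longrightarrow>
        (\<forall>k. prox_model t A b (x (Suc k)) (x k) - prox_model_min t A b (x k)
               \<le> \<rho>\<^sub>h / (2 * t) * (norm (x (Suc k) - x k))\<^sup>2) \<longrightarrow>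
        (let \<zeta> = L * sign_dist x_star (x 0) * (1 - 3 * \<rho>\<^sub>h) / (lam_s * (1 - 4 * \<rho>\<^sub>h))
         in \<forall>k. sign_dist x_star (x k)
                  \<le> lam_s * (1 - 4 * \<rho>\<^sub>h) / (L * (1 - 3 * \<rho>\<^sub>h)) * \<zeta> ^ (2 ^ k)))"
proof (intro conjI allI impI)
  have L_pos: "L > 0"
    using smoothness_const_pos_if_sharp[OF sharp lambda_pos] L by simp
  {
    fix \<rho> :: real and k
    define g where "g j = objective A b (x j) - objective A b x_star" for j
    define q where "q = (1 + 4 * \<rho>) / (2 + 4 * \<rho>)"
    assume \<rho>: "\<rho> > 0"
      and init: "objective A b (x 0) - objective A b x_star \<le> lam_s\<^sup>2 / (2 * L)"
      and inexact: "\<forall>k. prox_model t A b (x (Suc k)) (x k) - prox_model_min t A b (x k)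
        \<le> \<rho> * (prox_model t A b (x k) (x k) - prox_model t A b (x (Suc k)) (x k))"
    have q: "0 \<le> q" "q \<le> 1"
      using \<rho> by (auto simp: q_def field_simps)
    have g_nonneg: "0 \<le> g j" for j
      using sharp[of "x j"] sign_dist_nonneg[of x_star "x j"] lambda_pos
      unfolding g_def by (meson mult_nonneg_nonneg less_imp_le order_trans)
    have g: "g j \<le> g 0 * q ^ j" for j
    proof (induction j)
      case (Suc j)
      \<comment> \<open>Since \<open>q \<le> 1\<close>, the initial gap bound persists and the
        one-step estimate applies to every iterate.\<close>
      have "g 0 * q ^ j \<le> g 0"
        using q g_nonneg[of 0] by (simp add: mult_left_le power_le_one)
      then have "g j \<le> lam_s\<^sup>2 / (2 * L)"
        using Suc init by (simp add: g_def)
      then have "g (Suc j) \<le> q * g j"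
        unfolding g_def q_def using inexact
        by (intro prox_step_low_accuracy[OF sharp lambda_pos \<rho> L t]) auto
      also have "\<dots> \<le> q * (g 0 * q ^ j)"
        using Suc q by (intro mult_left_mono)
      finally show ?case
        by (simp add: mult.left_commute)
    qed simp
    have "sign_dist x_star (x k) \<le> g k / lam_s"
      using sharp[of "x k"] lambda_pos by (simp add: g_def field_simps)
    also have "\<dots> \<le> g 0 * q ^ k / lam_s"
      using g lambda_pos by (intro divide_right_mono) auto
    finally show "sign_dist x_star (x k)
        \<le> (objective A b (x 0) - objective A b x_star) / lam_s
           * ((1 + 4 * \<rho>) / (2 + 4 * \<rho>)) ^ k"
      by (simp add: g_def q_def)
  }
  {
    fix \<rho> :: real
    \<comment> \<open>This normalization turns the one-step estimate into
      \<open>e (Suc k) \<le> (e k)\<^sup>2\<close>; then \<open>e 0\<close> is \<zeta> and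
      \<open>1 / C\<close> is the leading constant.\<close>
    define C where "C = L * (1 - 3 * \<rho>) / (lam_s * (1 - 4 * \<rho>))"
    define e where "e k = C * sign_dist x_star (x k)" for k
    assume \<rho>: "0 < \<rho>" "\<rho> < 1 / 4"
      and inexact: "\<forall>k. prox_model t A b (x (Suc k)) (x k) - prox_model_min t A b (x k)
        \<le> \<rho> / (2 * t) * (norm (x (Suc k) - x k))\<^sup>2"
    have C_pos: "C > 0"
      using \<rho> L_pos lambda_pos by (simp add: C_def)
    have "e (Suc k) \<le> (e k)\<^sup>2" for k
    proof -
      have "lam_s * sign_dist x_star (x (Suc k)) \<le> lam_s * (C * (sign_dist x_star (x k))\<^sup>2)"
        using prox_step_high_accuracy[OF sharp lambda_pos \<rho> L t, of "x (Suc k)" "x k"]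
          inexact lambda_pos by (simp add: C_def)
      then have "sign_dist x_star (x (Suc k)) \<le> C * (sign_dist x_star (x k))\<^sup>2"
        using lambda_pos by simp
      then have "C * sign_dist x_star (x (Suc k)) \<le> C * (C * (sign_dist x_star (x k))\<^sup>2)"
        using C_pos by simp
      then show ?thesis
        by (simp add: e_def power2_eq_square mult_ac)
    qed
    then have "e k \<le> e 0 ^ (2 ^ k)" for k
      using C_pos by (intro quadratic_recursion_bound) (auto simp: e_def sign_dist_nonneg)
    then have "sign_dist x_star (x k) \<le> 1 / C * e 0 ^ (2 ^ k)" for k
      using C_pos by (simp add: e_def field_simps)
    moreover have "1 / C = lam_s * (1 - 4 * \<rho>) / (L * (1 - 3 * \<rho>))"
      by (simp add: C_def)
    moreover have "e 0 = L * sign_dist x_star (x 0) * (1 - 3 * \<rho>) / (lam_s * (1 - 4 * \<rho>))"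
      by (simp add: e_def C_def mult_ac)
    ultimately show "let \<zeta> = L * sign_dist x_star (x 0) * (1 - 3 * \<rho>) / (lam_s * (1 - 4 * \<rho>))
        in \<forall>k. sign_dist x_star (x k) \<le> lam_s * (1 - 4 * \<rho>) / (L * (1 - 3 * \<rho>)) * \<zeta> ^ (2 ^ k)"
      unfolding Let_def by metis
  }
qed

end
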